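(* If $G$, $H_1$ and $H_2$ are graphs with $H_1\subseteq H_2$ (i.e. $V(H_1)\subseteq V(H_2)$ and $E(H_1)\subseteq E(H_2)$), then $P_{G\to H_1}$ is a face of $P_{G\to H_2}$.
   Context: Graphs are finite and undirected without multiple edges; loops are allowed. A graph homomorphism $G\to H$ is a map $\phi:V(G)\to V(H)$ with $\phi(u)\phi(v)\in E(H)$ whenever $uv\in E(G)$. For $e\in E(G)$ let $G[e]$ be the subgraph consisting only of $e$ and its endpoint(s). Let $E_{G,H}$ be the set of pairs $(e,\rho)$ with $e\in E(G)$ and $\rho:G[e]\to H$ a graph homomorphism. The polytope of graph homomorphisms $P_{G\to H}$ is the convex hull in $\mathbb{R}^{E_{G,H}}$ of the points $x_\phi$, one for each graph homomorphism $\phi:G\to H$, whose $(e,\rho)$-coordinate is $1$ if $\phi|_{G[e]}=\rho$ and $0$ otherwise. When $H_1\subseteq H_2$ we have $E_{G,H_1}\subseteq E_{G,H_2}$, and $\mathbb{R}^{E_{G,H_1}}$ is regarded as the coordinate subspace of $\mathbb{R}^{E_{G,H_2}}$ in which the remaining coordinates are zero. A face of a polytope is the set of points where a valid linear inequality holds with equality; the polytope itself and the empty set count as faces. *)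

theory Defs
  imports "HOL-Analysis.Analysis" "HOL-Analysis.Finite_Function_Topology"
begin

text \<open>
  Finite undirected graphs without multiple edges, loops allowed.  An edge is the set of its
  endpoints, so a loop at \<open>v\<close> is the singleton \<open>{v}\<close>.
\<close>

record 'v graph =
  verts :: "'v set"
  edges :: "'v set set"

definition is_graph :: "'v graph \<Rightarrow> bool" where
  "is_graph G \<longleftrightarrow> finite (verts G) \<and>
     (\<forall>e\<in>edges G. \<exists>u\<in>verts G. \<exists>v\<in>verts G. e = {u, v})"

definition subgraph :: "'v graph \<Rightarrow> 'v graph \<Rightarrow> bool" where
  "subgraph H1 H2 \<longleftrightarrow> verts H1 \<subseteq> verts H2 \<and> edges H1 \<subseteq> edges H2"

text \<open>
  A map \<open>V(G) \<rightarrow> V(H)\<close> is represented by an extensional function, so that distinct elements of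
  \<open>homs G H\<close> are distinct as maps.
\<close>

definition homs :: "'v graph \<Rightarrow> 'w graph \<Rightarrow> ('v \<Rightarrow> 'w) set" where
  "homs G H = {\<phi> \<in> verts G \<rightarrow>\<^sub>E verts H.
     \<forall>u\<in>verts G. \<forall>v\<in>verts G. {u, v} \<in> edges G \<longrightarrow> {\<phi> u, \<phi> v} \<in> edges H}"

text \<open>The graph \<open>G[e]\<close>; it does not depend on the rest of \<open>G\<close>.\<close>

definition edge_graph :: "'v set \<Rightarrow> 'v graph" where
  "edge_graph e = \<lparr>verts = e, edges = {e}\<rparr>"

definition hom_coords :: "'v graph \<Rightarrow> 'w graph \<Rightarrow> ('v set \<times> ('v \<Rightarrow> 'w)) set" where
  "hom_coords G H = (SIGMA e:edges G. homs (edge_graph e) H)"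

text \<open>
  The spaces of real vectors indexed by finite sets of pairs \<open>(e, \<rho>)\<close> are taken as
  coordinate subspaces of the space of finitely supported real functions on the type of all
  such pairs.  So the coordinate space for \<open>H1\<close> lies inside that for a larger \<open>H2\<close>, with zeros in
  the remaining coordinates.  \<open>hom_vec\<close> is written in terms of the standard basis vectors;
  \<open>lookup_hom_vec\<close> below gives its coordinates.
\<close>

definition hom_vec ::
  "'v graph \<Rightarrow> 'w graph \<Rightarrow> ('v \<Rightarrow> 'w) \<Rightarrow> ('v set \<times> ('v \<Rightarrow> 'w)) \<Rightarrow>\<^sub>0 real" where
  "hom_vec G H \<phi> = (\<Sum>(e, \<rho>)\<in>hom_coords G H.
     Poly_Mapping.single (e, \<rho>) (if restrict \<phi> e = \<rho> then 1 else 0))"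

definition hom_polytope ::
  "'v graph \<Rightarrow> 'w graph \<Rightarrow> (('v set \<times> ('v \<Rightarrow> 'w)) \<Rightarrow>\<^sub>0 real) set" where
  "hom_polytope G H = convex hull (hom_vec G H ` homs G H)"

text \<open>
  A face is cut out by a valid linear inequality \<open>f x \<le> b\<close>.  Taking \<open>f = 0\<close> with \<open>b = 0\<close> or \<open>b = 1\<close>
  shows that \<open>P\<close> itself and the empty set are faces.  The library's
  \<open>face_of\<close> is the notion of an extreme subset, weaker for general convex sets, and \<open>exposed_face_of\<close> is restricted to Euclidean spaces.  Every linear
  functional on a coordinate subspace extends to the whole space, so it does not matter in which
  coordinate space containing \<open>P\<close> the inequality is taken.
\<close>

definition is_face :: "'a::real_vector set \<Rightarrow> 'a set \<Rightarrow> bool" where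
  "is_face F P \<longleftrightarrow> (\<exists>(f :: 'a \<Rightarrow> real) b. linear f \<and> (\<forall>x\<in>P. f x \<le> b) \<and> F = {x\<in>P. f x = b})"

lemma finite_hom_coords:
  assumes "is_graph G" "is_graph H"
  shows "finite (hom_coords G H)"
proof -
  have "edges G \<subseteq> Pow (verts G)"
    using assms(1) by (auto simp: is_graph_def)
  then have "finite (edges G)"
    using assms(1) by (auto simp: is_graph_def intro: finite_subset)
  moreover have "finite (homs (edge_graph e) H)" if "e \<in> edges G" for e
  proof (rule finite_subset)
    show "homs (edge_graph e) H \<subseteq> e \<rightarrow>\<^sub>E verts H"
      by (auto simp: homs_def edge_graph_def)
    show "finite (e \<rightarrow>\<^sub>E verts H)"
      using that assms by (intro finite_PiE) (auto simp: is_graph_def)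
  qed
  ultimately show ?thesis
    unfolding hom_coords_def by (rule finite_SigmaI)
qed

lemma lookup_hom_vec:
  assumes "is_graph G" "is_graph H"
  shows "Poly_Mapping.lookup (hom_vec G H \<phi>) (e, \<rho>) =
    (if (e, \<rho>) \<in> hom_coords G H \<and> restrict \<phi> e = \<rho> then 1 else 0)"
proof -
  have "Poly_Mapping.lookup (hom_vec G H \<phi>) (e, \<rho>) =
      (\<Sum>p\<in>hom_coords G H. if p = (e, \<rho>) then (if restrict \<phi> e = \<rho> then 1 else 0) else 0)"
    unfolding hom_vec_def Poly_Mapping.lookup_sum
    by (rule sum.cong) (auto simp: lookup_single when_def split: if_splits)
  also have "\<dots> = (if (e, \<rho>) \<in> hom_coords G H \<and> restrict \<phi> e = \<rho> then 1 else 0)"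
    using finite_hom_coords[OF assms] by (simp add: sum.delta)
  finally show ?thesis .
qed

end

theory Submission
  imports Defs
begin

text \<open>
  The face is cut out by the inequality saying that the sum of all coordinates \<open>(e, \<rho>)\<close> with
  \<open>\<rho>\<close> not a homomorphism into \<open>H1\<close> is nonnegative.  A vertex \<open>x\<^sub>\<phi>\<close> attains equality iff \<open>\<phi>\<close> maps
  every edge into \<open>H1\<close>.  Such a \<open>\<phi>\<close> may still send isolated vertices outside \<open>H1\<close>, but redirecting
  these to a fixed vertex of \<open>H1\<close> does not change \<open>x\<^sub>\<phi>\<close>.  This needs a vertex in \<open>H1\<close>; otherwise,
  unless \<open>G\<close> is empty, the polytope of \<open>H1\<close> is the empty face.
\<close>

text \<open>The set \<open>?T\<close> of points that satisfy the inequality, and lie in the hull of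
  the tight generators whenever they attain equality, contains \<open>S\<close> and is convex, so it
  contains the whole hull of \<open>S\<close>.\<close>

lemma convex_hull_Int_supporting_hyperplane:
  fixes f :: "'a::real_vector \<Rightarrow> real"
  assumes "linear f" and le: "\<And>s. s \<in> S \<Longrightarrow> f s \<le> b"
  shows "\<And>x. x \<in> convex hull S \<Longrightarrow> f x \<le> b"
    and "{x \<in> convex hull S. f x = b} = convex hull {s \<in> S. f s = b}"
proof -
  interpret f: linear f by fact
  let ?H = "convex hull {s \<in> S. f s = b}"
  let ?T = "{x. f x \<le> b \<and> (f x = b \<longrightarrow> x \<in> ?H)}"
  have "convex ?T"
  proof (rule convexI)
    fix x y :: 'a and u v :: real
    assume x: "x \<in> ?T" and y: "y \<in> ?T" and uv: "0 \<le> u" "0 \<le> v" "u + v = 1"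
    have fxy: "f (u *\<^sub>R x + v *\<^sub>R y) = u * f x + v * f y"
      by (simp add: f.add f.scaleR)
    have b: "b = u * b + v * b"
      using uv by (metis distrib_right mult_1)
    have ux: "u * f x \<le> u * b" and vy: "v * f y \<le> v * b"
      using x y uv by (auto intro: mult_left_mono)
    have "u *\<^sub>R x + v *\<^sub>R y \<in> ?H" if eq: "f (u *\<^sub>R x + v *\<^sub>R y) = b"
    proof -
      \<comment> \<open>Neither term exceeds its bound and the bounds add up to \<open>b\<close>, so
        both are attained. A point of weight zero need not be tight, hence the disjunctions that
        follow.\<close>
      have "u * f x = u * b" "v * f y = v * b"
        using eq fxy b ux vy by linarith+
      then have "u = 0 \<or> x \<in> ?H" "v = 0 \<or> y \<in> ?H"
        using x y by auto
      then show ?thesis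
        using uv convexD[OF convex_convex_hull, of x _ y u v] by auto
    qed
    then show "u *\<^sub>R x + v *\<^sub>R y \<in> ?T"
      using fxy b ux vy by auto
  qed
  moreover have "S \<subseteq> ?T"
    using le by (auto intro: hull_inc)
  ultimately have sub: "convex hull S \<subseteq> ?T"
    by (simp add: hull_minimal)
  then show "\<And>x. x \<in> convex hull S \<Longrightarrow> f x \<le> b"
    by auto
  have "convex (f -` {b})"
    using \<open>linear f\<close> by (simp add: convex_linear_vimage)
  then have "?H \<subseteq> f -` {b}"
    by (intro hull_minimal) auto
  moreover have "?H \<subseteq> convex hull S"
    by (intro hull_mono) auto
  ultimately show "{x \<in> convex hull S. f x = b} = ?H"
    using sub by auto
qed

lemma lookup_scaleR: "Poly_Mapping.lookup (r *\<^sub>R x) i = r *\<^sub>R Poly_Mapping.lookup x i"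
proof -
  have "finite {i. r *\<^sub>R Poly_Mapping.lookup x i \<noteq> 0}"
    by (rule finite_subset[OF _ finite_lookup[of x]]) auto
  then show ?thesis
    by (simp add: scaleR_poly_mapping_def)
qed

lemma homs_mono: "subgraph H1 H2 \<Longrightarrow> homs G H1 \<subseteq> homs G H2"
  unfolding homs_def subgraph_def
  using PiE_mono[of "verts G" "\<lambda>_. verts H1" "\<lambda>_. verts H2"] by blast

lemma edge_subset_verts: "is_graph G \<Longrightarrow> e \<in> edges G \<Longrightarrow> e \<subseteq> verts G"
  by (auto simp: is_graph_def)

lemma restrict_edge_homs:
  assumes "is_graph G" "\<phi> \<in> homs G H" "e \<in> edges G"
  shows "restrict \<phi> e \<in> homs (edge_graph e) H"
  using assms edge_subset_verts[OF assms(1,3)]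
  by (auto simp: homs_def edge_graph_def PiE_iff subset_iff)

text \<open>A coordinate vector sees a map only through its restrictions to edges. By
  \<open>into\<close>, the coordinates that \<open>H2\<close> adds to those of \<open>H1\<close> all
  vanish at \<open>\<phi>\<close>, even if \<open>\<phi>\<close> itself is no homomorphism into
  \<open>H1\<close>.\<close>

lemma hom_vec_eqI:
  assumes G: "is_graph G" and H: "is_graph H1" "is_graph H2" "subgraph H1 H2"
    and into: "\<And>e. e \<in> edges G \<Longrightarrow> restrict \<phi> e \<in> homs (edge_graph e) H1"
    and eq: "\<And>e. e \<in> edges G \<Longrightarrow> restrict \<psi> e = restrict \<phi> e"
  shows "hom_vec G H1 \<psi> = hom_vec G H2 \<phi>"
proof (rule poly_mapping_eqI)
  fix p :: "'a set \<times> ('a \<Rightarrow> 'b)"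
  obtain e \<rho> where p: "p = (e, \<rho>)" by (cases p)
  show "Poly_Mapping.lookup (hom_vec G H1 \<psi>) p = Poly_Mapping.lookup (hom_vec G H2 \<phi>) p"
    unfolding p lookup_hom_vec[OF G H(1)] lookup_hom_vec[OF G H(2)]
    using into[of e] eq[of e] homs_mono[OF H(3), of "edge_graph e"]
    by (auto simp: hom_coords_def)
qed

lemma hom_redirecting_isolated_verts:
  assumes G: "is_graph G" and H: "is_graph H"
    and w: "verts G = {} \<or> w \<in> verts H"
    and \<phi>: "\<And>e. e \<in> edges G \<Longrightarrow> restrict \<phi> e \<in> homs (edge_graph e) H"
  obtains \<psi> where "\<psi> \<in> homs G H" "\<forall>e\<in>edges G. restrict \<psi> e = restrict \<phi> e"
proof
  \<comment> \<open>The value \<open>undefined\<close> outside \<open>verts G\<close> makes the map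
    extensional, which is not assumed of \<open>\<phi>\<close>.\<close>
  let ?\<psi> = "\<lambda>u. if u \<in> \<Union>(edges G) then \<phi> u else if u \<in> verts G then w else undefined"
  show "\<forall>e\<in>edges G. restrict ?\<psi> e = restrict \<phi> e"
    by (auto simp: restrict_def)
  have "\<phi> u \<in> verts H" if "e \<in> edges G" "u \<in> e" for e u
    using \<phi>[OF that(1)] that(2) by (auto simp: homs_def edge_graph_def PiE_iff)
  then have "?\<psi> \<in> verts G \<rightarrow>\<^sub>E verts H"
    using w edge_subset_verts[OF G] by (auto simp: PiE_iff extensional_def)
  moreover have "{\<phi> u, \<phi> v} \<in> edges H" if "{u, v} \<in> edges G" for u v
    using \<phi>[OF that] by (auto simp: homs_def edge_graph_def)
  ultimately show "?\<psi> \<in> homs G H"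
    by (auto simp: homs_def)
qed

theorem theorem9p5:
  fixes G :: "'v graph" and H1 H2 :: "'w graph"
  assumes "is_graph G" and "is_graph H1" and "is_graph H2"
    and "subgraph H1 H2"
  shows "is_face (hom_polytope G H1) (hom_polytope G H2)"
proof (cases "verts G \<noteq> {} \<and> verts H1 = {}")
  case True
  then have "hom_polytope G H1 = {}"
    by (auto simp: hom_polytope_def homs_def PiE_eq_empty_iff)
  moreover have "linear (\<lambda>x :: ('v set \<times> ('v \<Rightarrow> 'w)) \<Rightarrow>\<^sub>0 real. 0 :: real)"
    by (rule linear_zero)
  ultimately show ?thesis
    unfolding is_face_def by (intro exI[of _ "\<lambda>_. 0"] exI[of _ 1]) auto
next
  case False
  then obtain w where w: "verts G = {} \<or> w \<in> verts H1"
    by auto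
  note G = assms(1) and H = assms(2-4)
  define D where "D = hom_coords G H2 - hom_coords G H1"
  define f :: "(('v set \<times> ('v \<Rightarrow> 'w)) \<Rightarrow>\<^sub>0 real) \<Rightarrow> real"
    \<comment> \<open>The sign turns nonnegativity of the sum into an upper bound, the form used in
      \<open>is_face\<close>.\<close>
    where "f x = - (\<Sum>p\<in>D. Poly_Mapping.lookup x p)" for x
  have "finite D"
    using finite_hom_coords[OF G H(2)] by (simp add: D_def)
  have "linear f"
    by (rule linearI) (simp_all add: f_def lookup_add lookup_scaleR sum.distrib sum_distrib_left)
  have nonneg: "Poly_Mapping.lookup (hom_vec G H2 \<phi>) p \<ge> 0" for \<phi> p
    by (cases p) (simp add: lookup_hom_vec[OF G H(2)])
  then have le: "f (hom_vec G H2 \<phi>) \<le> 0" for \<phi>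
    by (simp add: f_def sum_nonneg)
  have f_eq: "f (hom_vec G H2 \<phi>) = 0 \<longleftrightarrow>
      (\<forall>e\<in>edges G. restrict \<phi> e \<in> homs (edge_graph e) H1)"
    if "\<phi> \<in> homs G H2" for \<phi>
  proof -
    have "f (hom_vec G H2 \<phi>) = 0 \<longleftrightarrow> (\<forall>p\<in>D. Poly_Mapping.lookup (hom_vec G H2 \<phi>) p = 0)"
      using \<open>finite D\<close> nonneg by (simp add: f_def sum_nonneg_eq_0_iff)
    also have "\<dots> \<longleftrightarrow> (\<forall>(e, \<rho>)\<in>D. restrict \<phi> e \<noteq> \<rho>)"
      by (rule ball_cong) (auto simp: D_def lookup_hom_vec[OF G H(2)])
    \<comment> \<open>Each restriction of \<open>\<phi>\<close> is already a homomorphism into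
      \<open>H2\<close>, so avoiding \<open>D\<close> forces it to be one into
      \<open>H1\<close>.\<close>
    also have "\<dots> \<longleftrightarrow> (\<forall>e\<in>edges G. restrict \<phi> e \<in> homs (edge_graph e) H1)"
      using restrict_edge_homs[OF G that] by (auto simp: D_def hom_coords_def)
    finally show ?thesis .
  qed
  have vertices: "{x \<in> hom_vec G H2 ` homs G H2. f x = 0} = hom_vec G H1 ` homs G H1"
  proof (intro equalityI subsetI)
    fix x assume "x \<in> {x \<in> hom_vec G H2 ` homs G H2. f x = 0}"
    then obtain \<phi> where x: "x = hom_vec G H2 \<phi>"
      and \<phi>: "\<And>e. e \<in> edges G \<Longrightarrow> restrict \<phi> e \<in> homs (edge_graph e) H1"
      using f_eq by auto
    obtain \<psi> where \<psi>: "\<psi> \<in> homs G H1"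
      and eq: "\<forall>e\<in>edges G. restrict \<psi> e = restrict \<phi> e"
      by (rule hom_redirecting_isolated_verts[OF G H(1) w \<phi>])
    have "x = hom_vec G H1 \<psi>"
      unfolding x by (rule hom_vec_eqI[OF G H \<phi> bspec[OF eq], symmetric])
    with \<psi> show "x \<in> hom_vec G H1 ` homs G H1"
      by simp
  next
    fix x assume "x \<in> hom_vec G H1 ` homs G H1"
    then obtain \<phi> where x: "x = hom_vec G H1 \<phi>" and \<phi>: "\<phi> \<in> homs G H1"
      by auto
    have "\<phi> \<in> homs G H2"
      using \<phi> homs_mono[OF H(3)] by auto
    moreover have "x = hom_vec G H2 \<phi>"
      \<comment> \<open>Here both maps in \<open>hom_vec_eqI\<close> are \<open>\<phi>\<close>; only
        the target graph changes.\<close>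
      unfolding x using restrict_edge_homs[OF G \<phi>] by (intro hom_vec_eqI[OF G H]) auto
    ultimately show "x \<in> {x \<in> hom_vec G H2 ` homs G H2. f x = 0}"
      using f_eq restrict_edge_homs[OF G \<phi>] by auto
  qed
  have "\<forall>x\<in>hom_polytope G H2. f x \<le> 0"
    unfolding hom_polytope_def
    using convex_hull_Int_supporting_hyperplane(1)[OF \<open>linear f\<close>, of "hom_vec G H2 ` homs G H2"] le
    by blast
  moreover have "hom_polytope G H1 = {x \<in> hom_polytope G H2. f x = 0}"
    unfolding hom_polytope_def vertices[symmetric]
    by (rule convex_hull_Int_supporting_hyperplane(2)[OF \<open>linear f\<close>, symmetric]) (auto simp: le)
  ultimately show ?thesis
    using \<open>linear f\<close> unfolding is_face_def by blast
qed

end
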